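(* For every $x\in[x_0,x_n]$, $R_{\max}(P,x)=\max\{G(x),H(x)\}$.
   Context: A path $P$ has vertices at positions $0=x_0<x_1<\dots<x_n$; edge $(v_i,v_{i+1})$ has capacity $c_i>0$. A scenario $s$ gives nonnegative weights $w_t(s)$; $W_{i,j}(s)=\sum_{t=i}^jw_t(s)$. For $x\le x'$: $d(x,x')=x'-x$, $c(x,x')=\min\{c_t:i\le t<j\}$ with $i=\max\{i':x_{i'}\le x\}$, $j=\min\{j':x_{j'}\ge x'\}$. For $x_i<x$: $g_i(x:s)=d(x_i,x)+W_{0,i}(s)/c(x_i,x)$ if $W_{0,i}(s)>0$, else $0$; for $x_i>x$: $h_i(x:s)=d(x,x_i)+W_{i,n}(s)/c(x,x_i)$ if $W_{i,n}(s)>0$, else $0$. $\Theta_L(P,x:s)=\max_{i:x_i<x}g_i(x:s)$, $\Theta_R(P,x:s)=\max_{i:x_i>x}h_i(x:s)$ (empty maximum $=0$), $\Theta(P,x:s)=\max\{\Theta_L,\Theta_R\}$, $\Theta_{OPT}(P:s)=\min_{x\in[x_0,x_n]}\Theta(P,x:s)$. Weight intervals $[w_i^-,w_i^+]$, $0\le w_i^-\le w_i^+$, $\mathcal S=\prod_i[w_i^-,w_i^+]$, $R_{\max}(P,x)=\max_{s\in\mathcal S}(\Theta(P,x:s)-\Theta_{OPT}(P:s))$. For $i\le j$, $s_{i,j}(\alpha,\beta)$ has $w_t=w_t^-$ for $t<i$ or $t>j$, $w_t^+$ for $i<t<j$, $w_i=\alpha$, $w_j=\beta$ ($\alpha=\beta$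 if $i=j$); $S_{i,j}=\{s_{i,j}(\alpha,\beta):\alpha\in[w_i^-,w_i^+],\beta\in[w_j^-,w_j^+]\}$. For $i<j$ define $G_j(x)=\max_{s\in S_{j,j}}\{g_j(x:s)-\min_{y\in[x_j,x_n]}\Theta(P,y:s)\}$, $H_i(x)=\max_{s\in S_{i,i}}\{h_i(x:s)-\min_{y\in[x_0,x_i]}\Theta(P,y:s)\}$, $G_{i,j}(x)=\max_{s\in S_{i,j},w_j(s)=w_j^+}\{g_j(x:s)-\min_{y\in[x_j,x_n]}\Theta(P,y:s)\}$, $\bar G_{i,j}(x)=\max_{s\in S_{i,j}}\{\max_{t:x_j\le x_t<x}g_t(x:s)-\min_{y\in[x_i,x_j]}\Theta(P,y:s)\}$, $H_{i,j}(x)=\max_{s\in S_{i,j},w_i(s)=w_i^+}\{h_i(x:s)-\min_{y\in[x_0,x_i]}\Theta(P,y:s)\}$, $\bar H_{i,j}(x)=\max_{s\in S_{i,j}}\{\max_{t:x<x_t\le x_i}h_t(x:s)-\min_{y\in[x_i,x_j]}\Theta(P,y:s)\}$. Then $G(x)=\max\{\max_{j:x_j<x}G_j(x),\ \max_{i<j:\,x_j<x}G_{i,j}(x),\ \max_{i<j:\,x_j<x}\bar G_{i,j}(x)\}$ and $H(x)=\max\{\max_{i:x<x_i}H_i(x),\ \max_{i<j:\,x<x_i}H_{i,j}(x),\ \max_{i<j:\,x<x_i}\bar H_{i,j}(x)\}$, where maxima over empty index families are omitted (taken as $-\infty$). *)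

theory Defs
  imports Complex_Main "HOL-Library.FuncSet" "HOL-Library.Extended_Real"
begin

text \<open>
  A path with vertices \<open>0, \<dots>, len P\<close>, where \<open>cap P i\<close> is the capacity of the edge between
  vertices \<open>i\<close> and \<open>i + 1\<close>, and \<open>[wlo P i, whi P i]\<close> is the weight interval of vertex \<open>i\<close>.
  Only indices up to \<open>len P\<close> are meaningful.
\<close>

record path_network =
  len :: nat
  pos :: "nat \<Rightarrow> real"
  cap :: "nat \<Rightarrow> real"
  wlo :: "nat \<Rightarrow> real"
  whi :: "nat \<Rightarrow> real"

definition valid_path :: "path_network \<Rightarrow> bool" where
  "valid_path P \<longleftrightarrow>
     1 \<le> len P \<and> pos P 0 = 0 \<and>
     (\<forall>i<len P. pos P i < pos P (Suc i)) \<and>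
     (\<forall>i<len P. 0 < cap P i) \<and>
     (\<forall>i\<le>len P. 0 \<le> wlo P i \<and> wlo P i \<le> whi P i)"

type_synonym scenario = "nat \<Rightarrow> real"

definition scenarios :: "path_network \<Rightarrow> scenario set" where
  "scenarios P = PiE {..len P} (\<lambda>i. {wlo P i..whi P i})"

definition W :: "scenario \<Rightarrow> nat \<Rightarrow> nat \<Rightarrow> real" where
  "W s i j = (\<Sum>t=i..j. s t)"

definition path_dist :: "real \<Rightarrow> real \<Rightarrow> real" where
  "path_dist x x' = x' - x"

definition path_cap :: "path_network \<Rightarrow> real \<Rightarrow> real \<Rightarrow> real" where
  "path_cap P x x' =
     (let i = Max {i'. i' \<le> len P \<and> pos P i' \<le> x};
          j = Min {j'. j' \<le> len P \<and> x' \<le> pos P j'}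
      in Min (cap P ` {i..<j}))"

definition g :: "path_network \<Rightarrow> nat \<Rightarrow> real \<Rightarrow> scenario \<Rightarrow> real" where
  "g P i x s =
     (if W s 0 i > 0 then path_dist (pos P i) x + W s 0 i / path_cap P (pos P i) x else 0)"

definition h :: "path_network \<Rightarrow> nat \<Rightarrow> real \<Rightarrow> scenario \<Rightarrow> real" where
  "h P i x s =
     (if W s i (len P) > 0
      then path_dist x (pos P i) + W s i (len P) / path_cap P x (pos P i) else 0)"

definition Theta_L :: "path_network \<Rightarrow> real \<Rightarrow> scenario \<Rightarrow> real" where
  "Theta_L P x s =
     (let I = {i. i \<le> len P \<and> pos P i < x}
      in if I = {} then 0 else Max ((\<lambda>i. g P i x s) ` I))"

definition Theta_R :: "path_network \<Rightarrow> real \<Rightarrow> scenario \<Rightarrow> real" where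
  "Theta_R P x s =
     (let I = {i. i \<le> len P \<and> x < pos P i}
      in if I = {} then 0 else Max ((\<lambda>i. h P i x s) ` I))"

definition Theta :: "path_network \<Rightarrow> real \<Rightarrow> scenario \<Rightarrow> real" where
  "Theta P x s = max (Theta_L P x s) (Theta_R P x s)"

text \<open>
  Minima over sink locations and maxima over scenarios are rendered as infima and suprema.
  The former are attained, since \<open>Theta P\<close> is lower semicontinuous in the location. The latter
  need not be, since \<open>g\<close> and \<open>h\<close> jump where a cumulative weight becomes zero. Let the positions
  be \<open>0, 1, 2\<close>, the capacities \<open>10, 1\<close>, and the weight intervals \<open>[0, 1]\<close>, \<open>[10, 10]\<close>,
  \<open>[1000, 1000]\<close>. Then the values whose supremum is \<open>G_single P 0 (1/2)\<close> below are
  \<open>- 10.5 - 0.9 * a\<close> for weight \<open>a > 0\<close> at vertex \<open>0\<close>, but \<open>- 11\<close> for \<open>a = 0\<close>.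
\<close>

definition min_Theta :: "path_network \<Rightarrow> real \<Rightarrow> real \<Rightarrow> scenario \<Rightarrow> real" where
  "min_Theta P a b s = (INF y\<in>{a..b}. Theta P y s)"

definition Theta_OPT :: "path_network \<Rightarrow> scenario \<Rightarrow> real" where
  "Theta_OPT P s = min_Theta P (pos P 0) (pos P (len P)) s"

definition R_max :: "path_network \<Rightarrow> real \<Rightarrow> real" where
  "R_max P x = (SUP s\<in>scenarios P. Theta P x s - Theta_OPT P s)"

definition scen :: "path_network \<Rightarrow> nat \<Rightarrow> nat \<Rightarrow> real \<Rightarrow> real \<Rightarrow> scenario" where
  "scen P i j \<alpha> \<beta> =
     (\<lambda>t\<in>{..len P}. if t = i then \<alpha> else if t = j then \<beta>
                   else if i < t \<and> t < j then whi P t else wlo P t)"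

definition Scen :: "path_network \<Rightarrow> nat \<Rightarrow> nat \<Rightarrow> scenario set" where
  "Scen P i j =
     {scen P i j \<alpha> \<beta> | \<alpha> \<beta>.
        \<alpha> \<in> {wlo P i..whi P i} \<and> \<beta> \<in> {wlo P j..whi P j} \<and> (i = j \<longrightarrow> \<alpha> = \<beta>)}"

definition G_single :: "path_network \<Rightarrow> nat \<Rightarrow> real \<Rightarrow> real" where
  "G_single P j x =
     (SUP s\<in>Scen P j j. g P j x s - min_Theta P (pos P j) (pos P (len P)) s)"

definition H_single :: "path_network \<Rightarrow> nat \<Rightarrow> real \<Rightarrow> real" where
  "H_single P i x =
     (SUP s\<in>Scen P i i. h P i x s - min_Theta P (pos P 0) (pos P i) s)"

definition G_pair :: "path_network \<Rightarrow> nat \<Rightarrow> nat \<Rightarrow> real \<Rightarrow> real" where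
  "G_pair P i j x =
     (SUP s\<in>{s \<in> Scen P i j. s j = whi P j}.
        g P j x s - min_Theta P (pos P j) (pos P (len P)) s)"

definition G_bar :: "path_network \<Rightarrow> nat \<Rightarrow> nat \<Rightarrow> real \<Rightarrow> real" where
  "G_bar P i j x =
     (SUP s\<in>Scen P i j.
        Max ((\<lambda>t. g P t x s) ` {t. t \<le> len P \<and> pos P j \<le> pos P t \<and> pos P t < x})
        - min_Theta P (pos P i) (pos P j) s)"

definition H_pair :: "path_network \<Rightarrow> nat \<Rightarrow> nat \<Rightarrow> real \<Rightarrow> real" where
  "H_pair P i j x =
     (SUP s\<in>{s \<in> Scen P i j. s i = whi P i}.
        h P i x s - min_Theta P (pos P 0) (pos P i) s)"

definition H_bar :: "path_network \<Rightarrow> nat \<Rightarrow> nat \<Rightarrow> real \<Rightarrow> real" where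
  "H_bar P i j x =
     (SUP s\<in>Scen P i j.
        Max ((\<lambda>t. h P t x s) ` {t. t \<le> len P \<and> x < pos P t \<and> pos P t \<le> pos P i})
        - min_Theta P (pos P i) (pos P j) s)"

text \<open>
  The outer maxima are taken in the extended reals, where the supremum of an empty family
  is \<open>- \<infinity>\<close>.
\<close>

definition G :: "path_network \<Rightarrow> real \<Rightarrow> ereal" where
  "G P x =
     (let J = {j. j \<le> len P \<and> pos P j < x};
          IJ = {(i, j). i < j \<and> j \<le> len P \<and> pos P j < x}
      in max (SUP j\<in>J. ereal (G_single P j x))
          (max (SUP (i, j)\<in>IJ. ereal (G_pair P i j x))
               (SUP (i, j)\<in>IJ. ereal (G_bar P i j x))))"

definition H :: "path_network \<Rightarrow> real \<Rightarrow> ereal" where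
  "H P x =
     (let I = {i. i \<le> len P \<and> x < pos P i};
          IJ = {(i, j). i < j \<and> j \<le> len P \<and> x < pos P i}
      in max (SUP i\<in>I. ereal (H_single P i x))
          (max (SUP (i, j)\<in>IJ. ereal (H_pair P i j x))
               (SUP (i, j)\<in>IJ. ereal (H_bar P i j x))))"

end

theory Submission imports Defs begin

text \<open>
  The inequality \<open>\<ge>\<close> is monotonicity. For \<open>\<le>\<close>, fix a scenario \<open>s\<close> and a competing sink \<open>y\<close>, and let
  \<open>\<Theta>(x : s) = g\<^sub>k(x : s)\<close>; the case of \<open>h\<^sub>k\<close> is symmetric. Lower all weights to the right of
  \<open>x\<^sub>k\<close> to their minimum and move the weights at \<open>x\<^sub>0, \<dots>, x\<^sub>k\<close> as far towards \<open>y\<close> as the weight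
  intervals permit, keeping the total on each side of \<open>y\<close> fixed. The value \<open>g\<^sub>k(x : s)\<close> depends
  only on the total and stays the same, while no term of \<open>\<Theta>(y : s)\<close> increases. The resulting scenario
  belongs to some \<open>S\<^sub>k\<^sub>,\<^sub>k\<close> or \<open>S\<^sub>i\<^sub>,\<^sub>k\<close> (with maximal weight at \<open>k\<close>) if \<open>y \<ge> x\<^sub>k\<close>, and to some
  \<open>S\<^sub>i\<^sub>,\<^sub>j\<close> with \<open>x\<^sub>i \<le> y \<le> x\<^sub>j \<le> x\<^sub>k\<close> otherwise.
\<close>

section \<open>Greedy filling of weight intervals up to a prescribed total\<close>

text \<open>The rightmost weights are exhausted first: the last index is raised to \<open>hi\<close>
  as long as the remainder still covers the lower bounds of the others; otherwise it is itself the
  partially filled one.\<close>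

lemma fill_right:
  fixes lo hi :: "nat \<Rightarrow> real"
  assumes "a \<le> m" "(\<Sum>t=a..m. lo t) \<le> A" "A \<le> (\<Sum>t=a..m. hi t)"
  shows "\<exists>i \<alpha>. i \<in> {a..m} \<and> \<alpha> \<in> {lo i..hi i} \<and>
           (\<Sum>t=a..m. if t = i then \<alpha> else if i < t then hi t else lo t) = A"
  using assms
proof (induction m arbitrary: A rule: dec_induct)
  case base
  then show ?case by (intro exI[of _ a] exI[of _ A]) simp
next
  case (step m)
  show ?case
  proof (cases "(\<Sum>t=a..m. lo t) \<le> A - hi (Suc m)")
    case True
    moreover have "A - hi (Suc m) \<le> (\<Sum>t=a..m. hi t)"
      using step by simp
    ultimately obtain i \<alpha> where "i \<in> {a..m}" "\<alpha> \<in> {lo i..hi i}"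
        "(\<Sum>t=a..m. if t = i then \<alpha> else if i < t then hi t else lo t) = A - hi (Suc m)"
      using step.IH by blast
    then show ?thesis
      using step.hyps by (intro exI[of _ i] exI[of _ \<alpha>]) auto
  next
    case False
    \<comment> \<open>With \<open>Suc m\<close> as the partial index all earlier weights stay at
      \<open>lo\<close>, so it must carry \<open>A\<close> minus their sum; the failed case
      condition keeps this below \<open>hi (Suc m)\<close>.\<close>
    have "(\<Sum>t=a..m. if t = Suc m then \<alpha> else if Suc m < t then hi t else lo t)
        = (\<Sum>t=a..m. lo t)" for \<alpha>
      by (rule sum.cong) auto
    then show ?thesis
      using False step by (intro exI[of _ "Suc m"] exI[of _ "A - (\<Sum>t=a..m. lo t)"]) simp
  qed
qed

text \<open>The induction again removes the last index: it stays at \<open>lo\<close> as long as the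
  earlier ones have room for \<open>A - lo (Suc m)\<close>; otherwise they are all full and
  \<open>Suc m\<close> takes the rest.\<close>

lemma fill_left:
  fixes lo hi :: "nat \<Rightarrow> real"
  assumes "a \<le> m" "(\<Sum>t=a..m. lo t) \<le> A" "A \<le> (\<Sum>t=a..m. hi t)"
  shows "\<exists>j \<beta>. j \<in> {a..m} \<and> \<beta> \<in> {lo j..hi j} \<and>
           (\<Sum>t=a..m. if t = j then \<beta> else if t < j then hi t else lo t) = A"
  using assms
proof (induction m arbitrary: A rule: dec_induct)
  case base
  then show ?case by (intro exI[of _ a] exI[of _ A]) simp
next
  case (step m)
  show ?case
  proof (cases "A - lo (Suc m) \<le> (\<Sum>t=a..m. hi t)")
    case True
    moreover have "(\<Sum>t=a..m. lo t) \<le> A - lo (Suc m)"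
      using step by simp
    ultimately obtain j \<beta> where "j \<in> {a..m}" "\<beta> \<in> {lo j..hi j}"
        "(\<Sum>t=a..m. if t = j then \<beta> else if t < j then hi t else lo t) = A - lo (Suc m)"
      using step.IH by blast
    then show ?thesis
      using step.hyps by (intro exI[of _ j] exI[of _ \<beta>]) auto
  next
    case False
    have "(\<Sum>t=a..m. if t = Suc m then \<beta> else if t < Suc m then hi t else lo t)
        = (\<Sum>t=a..m. hi t)" for \<beta>
      by (rule sum.cong) auto
    then show ?thesis
      using False step by (intro exI[of _ "Suc m"] exI[of _ "A - (\<Sum>t=a..m. hi t)"]) simp
  qed
qed

section \<open>Partial sums of two weightings that cross once\<close>

lemma W_split: "i \<le> m \<Longrightarrow> m < j \<Longrightarrow> W s i j = W s i m + W s (Suc m) j"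
  using sum.ub_add_nat[of i m s "j - m"] by (simp add: W_def)

lemma W_mono: "(\<And>t. i \<le> t \<Longrightarrow> t \<le> j \<Longrightarrow> u t \<le> s t) \<Longrightarrow> W u i j \<le> W s i j"
  unfolding W_def by (intro sum_mono) auto

text \<open>Prefixes ending before \<open>i\<close> compare termwise. From \<open>i\<close> on, the
  prefix sums of \<open>u - s\<close> increase towards their value at \<open>m\<close>, which is not
  positive; this covers the index \<open>i\<close>, where the two weights themselves are not
  compared.\<close>

lemma W_prefix_mono_if_crossing:
  assumes "\<And>t. t < i \<Longrightarrow> t \<le> m \<Longrightarrow> u t \<le> s t" "\<And>t. i < t \<Longrightarrow> t \<le> m \<Longrightarrow> s t \<le> u t"
    and "W u 0 m \<le> W s 0 m" "t \<le> m"
  shows "W u 0 t \<le> W s 0 t"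
proof -
  consider "t < i" | "t = m" | "i \<le> t" "t < m" using assms(4) by linarith
  then show ?thesis
  proof cases
    case 1
    then show ?thesis using assms by (intro W_mono) auto
  next
    case 3
    then have "W s (Suc t) m \<le> W u (Suc t) m" using assms by (intro W_mono) auto
    then show ?thesis using 3 assms(3) W_split[of 0 t m] by simp
  qed (use assms in auto)
qed

lemma W_suffix_mono_if_crossing:
  assumes "\<And>t. m \<le> t \<Longrightarrow> t < j \<Longrightarrow> s t \<le> u t" "\<And>t. j < t \<Longrightarrow> t \<le> n \<Longrightarrow> u t \<le> s t"
    and "W u m n \<le> W s m n" "m \<le> t" "t \<le> n"
  shows "W u t n \<le> W s t n"
proof -
  consider "j < t" | "t = m" | "t \<le> j" "m < t" using assms(4) by linarith
  then show ?thesis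
  proof cases
    case 1
    then show ?thesis using assms by (intro W_mono) auto
  next
    case 3
    then obtain r where r: "t = Suc r" by (cases t) auto
    then have "W s m r \<le> W u m r" using 3 assms by (intro W_mono) auto
    then show ?thesis using 3 r assms W_split[of m r n] by simp
  qed (use assms in auto)
qed

section \<open>Positions, capacities and the single terms \<open>g\<close> and
  \<open>h\<close>\<close>

context
  fixes P :: path_network
  assumes valid: "valid_path P"
begin

lemma pos_less: "i < j \<Longrightarrow> j \<le> len P \<Longrightarrow> pos P i < pos P j"
proof (induction j)
  case (Suc j)
  then have "pos P j < pos P (Suc j)" using valid by (simp add: valid_path_def)
  then show ?case using Suc by (cases "i = j") auto
qed simp

lemma pos_less_iff: "i \<le> len P \<Longrightarrow> j \<le> len P \<Longrightarrow> pos P i < pos P j \<longleftrightarrow> i < j"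
  by (metis linorder_neqE_nat order_less_asym pos_less)

lemma pos_le_iff: "i \<le> len P \<Longrightarrow> j \<le> len P \<Longrightarrow> pos P i \<le> pos P j \<longleftrightarrow> i \<le> j"
  using pos_less_iff[of j i] by (simp add: not_less[symmetric])

lemma wlo_le_whi: "t \<le> len P \<Longrightarrow> wlo P t \<le> whi P t"
  using valid by (simp add: valid_path_def)

lemma path_cap_pos:
  assumes "pos P 0 \<le> a" "a < b" "b \<le> pos P (len P)"
  shows "0 < path_cap P a b"
proof -
  define i where "i = Max {i'. i' \<le> len P \<and> pos P i' \<le> a}"
  define j where "j = Min {j'. j' \<le> len P \<and> b \<le> pos P j'}"
  have i: "i \<in> {i'. i' \<le> len P \<and> pos P i' \<le> a}"
    unfolding i_def using assms by (intro Max_in) auto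
  have j: "j \<in> {j'. j' \<le> len P \<and> b \<le> pos P j'}"
    unfolding j_def using assms by (intro Min_in) auto
  \<comment> \<open>Strictness of \<open>a < b\<close> makes the edge range \<open>{i..<j}\<close>
    nonempty, so its \<open>Min\<close> is a genuine minimum of positive capacities.\<close>
  have "pos P i < pos P j" using i j assms by auto
  then have "i < j" using i j pos_less_iff by simp
  moreover have "0 < cap P t" if "t < j" for t
    using that j valid by (simp add: valid_path_def)
  ultimately have "0 < Min (cap P ` {i..<j})" by (subst Min_gr_iff) auto
  then show ?thesis by (simp add: path_cap_def i_def j_def)
qed

lemma g_nonneg:
  assumes "i \<le> len P" "pos P i < x" "x \<le> pos P (len P)"
  shows "0 \<le> g P i x s"
proof -
  have "0 < path_cap P (pos P i) x"
    using assms pos_le_iff[of 0 i] by (intro path_cap_pos) auto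
  then show ?thesis using assms by (auto simp: g_def path_dist_def)
qed

lemma h_nonneg:
  assumes "i \<le> len P" "x < pos P i" "pos P 0 \<le> x"
  shows "0 \<le> h P i x s"
proof -
  have "0 < path_cap P x (pos P i)"
    using assms pos_le_iff[of i "len P"] by (intro path_cap_pos) auto
  then show ?thesis using assms by (auto simp: h_def path_dist_def)
qed

text \<open>The jump of \<open>g\<close> at vanishing cumulative weight is harmless: there
  \<open>g\<close> is 0, a lower bound for all its values by \<open>g_nonneg\<close>, and for
  positive weight it is affine with positive slope.\<close>

lemma g_mono:
  assumes "i \<le> len P" "pos P i < x" "x \<le> pos P (len P)" "W s 0 i \<le> W s' 0 i"
  shows "g P i x s \<le> g P i x s'"
proof -
  have "0 < path_cap P (pos P i) x"
    using assms pos_le_iff[of 0 i] by (intro path_cap_pos) auto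
  then show ?thesis
    using g_nonneg[OF assms(1-3), of s'] assms(4) by (auto simp: g_def divide_right_mono)
qed

lemma h_mono:
  assumes "i \<le> len P" "x < pos P i" "pos P 0 \<le> x" "W s i (len P) \<le> W s' i (len P)"
  shows "h P i x s \<le> h P i x s'"
proof -
  have "0 < path_cap P x (pos P i)"
    using assms pos_le_iff[of i "len P"] by (intro path_cap_pos) auto
  then show ?thesis
    using h_nonneg[OF assms(1-3), of s'] assms(4) by (auto simp: h_def divide_right_mono)
qed

section \<open>Reduction of \<open>Theta\<close> to a single term\<close>

lemma g_le_Theta: "i \<le> len P \<Longrightarrow> pos P i < x \<Longrightarrow> g P i x s \<le> Theta P x s"
  unfolding Theta_def Theta_L_def Let_def by (auto intro!: Max_ge simp: le_max_iff_disj)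

lemma h_le_Theta: "i \<le> len P \<Longrightarrow> x < pos P i \<Longrightarrow> h P i x s \<le> Theta P x s"
  unfolding Theta_def Theta_R_def Let_def by (auto intro!: Max_ge simp: le_max_iff_disj)

text \<open>The path has an edge, so some vertex lies strictly on one side of \<open>x\<close>. An
  empty side contributes the default 0, which never exceeds the other side because \<open>g\<close>
  and \<open>h\<close> are nonnegative. Regret bounds thus only have to treat one \<open>g\<close>
  or one \<open>h\<close>.\<close>

lemma Theta_attained:
  assumes "x \<in> {pos P 0..pos P (len P)}"
  obtains k where "k \<le> len P" "pos P k < x" "Theta P x s = g P k x s"
  | k where "k \<le> len P" "x < pos P k" "Theta P x s = h P k x s"
proof -
  let ?I = "{i. i \<le> len P \<and> pos P i < x}" and ?J = "{i. i \<le> len P \<and> x < pos P i}"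
  have L: "\<exists>k. k \<in> ?I \<and> Theta_L P x s = g P k x s" if "?I \<noteq> {}"
  proof -
    have "Theta_L P x s = Max ((\<lambda>i. g P i x s) ` ?I)"
      by (simp only: Theta_L_def Let_def that if_False)
    also have "\<dots> \<in> (\<lambda>i. g P i x s) ` ?I" using that by (intro Max_in) auto
    finally show ?thesis by blast
  qed
  have R: "\<exists>k. k \<in> ?J \<and> Theta_R P x s = h P k x s" if "?J \<noteq> {}"
  proof -
    have "Theta_R P x s = Max ((\<lambda>i. h P i x s) ` ?J)"
      by (simp only: Theta_R_def Let_def that if_False)
    also have "\<dots> \<in> (\<lambda>i. h P i x s) ` ?J" using that by (intro Max_in) auto
    finally show ?thesis by blast
  qed
  have "pos P 0 < pos P (len P)" using pos_less[of 0 "len P"] valid by (simp add: valid_path_def)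
  then have "pos P 0 < x \<or> x < pos P (len P)" by linarith
  then have ne: "?I \<noteq> {} \<or> ?J \<noteq> {}" by blast
  have L0: "Theta_L P x s = 0" if "?I = {}" using that by (simp add: Theta_L_def Let_def)
  have R0: "Theta_R P x s = 0" if "?J = {}" using that by (simp add: Theta_R_def Let_def)
  have "(\<exists>k\<in>?I. Theta P x s = g P k x s) \<or> (\<exists>k\<in>?J. Theta P x s = h P k x s)"
  proof (cases "?I = {}")
    case True
    then obtain k where "k \<in> ?J" "Theta_R P x s = h P k x s" using ne R by blast
    moreover from this have "0 \<le> h P k x s" using h_nonneg assms by auto
    ultimately show ?thesis using L0[OF True] unfolding Theta_def by auto
  next
    case I: False
    then obtain k where k: "k \<in> ?I" "Theta_L P x s = g P k x s" using L by blast
    then have k0: "0 \<le> g P k x s" using g_nonneg assms by auto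
    show ?thesis
    proof (cases "?J = {}")
      case True
      then show ?thesis using k k0 R0 unfolding Theta_def by auto
    next
      case False
      then obtain k' where "k' \<in> ?J" "Theta_R P x s = h P k' x s" using R by blast
      then show ?thesis using k unfolding Theta_def max_def by auto
    qed
  qed
  then show thesis using that by blast
qed

lemma Theta_nonneg: "x \<in> {pos P 0..pos P (len P)} \<Longrightarrow> 0 \<le> Theta P x s"
  using Theta_attained[of x s] g_nonneg h_nonneg by (metis atLeastAtMost_iff)

text \<open>It suffices to compare the term attaining \<open>Theta P x s\<close>. Only prefixes
  ending strictly left of \<open>x\<close> and suffixes starting strictly right of it matter, which
  is what lets weight be moved towards \<open>x\<close>.\<close>

lemma Theta_mono:
  assumes "x \<in> {pos P 0..pos P (len P)}"
    and "\<And>t. t \<le> len P \<Longrightarrow> pos P t < x \<Longrightarrow> W s 0 t \<le> W s' 0 t"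
    and "\<And>t. t \<le> len P \<Longrightarrow> x < pos P t \<Longrightarrow> W s t (len P) \<le> W s' t (len P)"
  shows "Theta P x s \<le> Theta P x s'"
proof (cases rule: Theta_attained[OF assms(1), of s])
  case (1 k)
  then have "g P k x s \<le> g P k x s'" using assms g_mono by auto
  also have "\<dots> \<le> Theta P x s'" using 1 g_le_Theta by simp
  finally show ?thesis using 1 by simp
next
  case (2 k)
  then have "h P k x s \<le> h P k x s'" using assms h_mono by auto
  also have "\<dots> \<le> Theta P x s'" using 2 h_le_Theta by simp
  finally show ?thesis using 2 by simp
qed

section \<open>Scenarios, restricted minima and regret\<close>

lemma scenarios_bounds:
  assumes "s \<in> scenarios P" "t \<le> len P"
  shows "wlo P t \<le> s t" "s t \<le> whi P t"
  using assms by (auto simp: scenarios_def dest!: PiE_mem[of _ _ _ t])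

text \<open>Provides the bound, uniform in the scenario, behind the real supremum in
  \<open>R_max\<close>; \<open>whi P\<close> serves here as a plain weight function.\<close>

lemma Theta_le_whi:
  assumes "s \<in> scenarios P" "x \<in> {pos P 0..pos P (len P)}"
  shows "Theta P x s \<le> Theta P x (whi P)"
  using assms by (intro Theta_mono W_mono) (auto intro: scenarios_bounds)

lemma Scen_subset: "i \<le> len P \<Longrightarrow> j \<le> len P \<Longrightarrow> Scen P i j \<subseteq> scenarios P"
  using wlo_le_whi by (auto simp: Scen_def scenarios_def scen_def split: if_splits)

lemma scen_in_Scen:
  assumes "\<alpha> \<in> {wlo P i..whi P i}" "\<beta> \<in> {wlo P j..whi P j}" "i = j \<Longrightarrow> \<alpha> = \<beta>"
  shows "scen P i j \<alpha> \<beta> \<in> Scen P i j"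
  using assms unfolding Scen_def by blast

lemma Scen_whi_nonempty:
  assumes "i \<le> len P" "j \<le> len P"
  shows "scen P i j (whi P i) (whi P j) \<in> Scen P i j"
  using assms wlo_le_whi by (intro scen_in_Scen) auto

lemma min_Theta_le:
  assumes "pos P 0 \<le> a" "b \<le> pos P (len P)" "y \<in> {a..b}"
  shows "min_Theta P a b s \<le> Theta P y s"
  unfolding min_Theta_def using assms
  by (intro cINF_lower bdd_belowI2[where m = 0] Theta_nonneg) auto

lemma min_Theta_nonneg:
  assumes "pos P 0 \<le> a" "a \<le> b" "b \<le> pos P (len P)"
  shows "0 \<le> min_Theta P a b s"
  unfolding min_Theta_def using assms by (intro cINF_greatest Theta_nonneg) auto

lemma Theta_OPT_le_min_Theta:
  assumes "pos P 0 \<le> a" "a \<le> b" "b \<le> pos P (len P)"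
  shows "Theta_OPT P s \<le> min_Theta P a b s"
  unfolding min_Theta_def[of P a b] Theta_OPT_def
  using assms by (intro cINF_greatest min_Theta_le) auto

text \<open>A competing sink confined to \<open>{a..b}\<close> does no better than the overall
  optimum, and \<open>v\<close> does not exceed the cost at \<open>x\<close>, so the difference is
  at most the regret of \<open>s\<close>.\<close>

lemma regret_le_R_max:
  assumes "x \<in> {pos P 0..pos P (len P)}" "s \<in> scenarios P" "v \<le> Theta P x s"
    and "pos P 0 \<le> a" "a \<le> b" "b \<le> pos P (len P)"
  shows "v - min_Theta P a b s \<le> R_max P x"
proof -
  have "bdd_above ((\<lambda>s. Theta P x s - Theta_OPT P s) ` scenarios P)"
  proof (rule bdd_aboveI2)
    fix s assume "s \<in> scenarios P"
    moreover have "0 \<le> Theta_OPT P s"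
      using assms unfolding Theta_OPT_def by (intro min_Theta_nonneg) auto
    ultimately show "Theta P x s - Theta_OPT P s \<le> Theta P x (whi P)"
      using Theta_le_whi[of s x] assms(1) by simp
  qed
  then have "Theta P x s - Theta_OPT P s \<le> R_max P x"
    unfolding R_max_def using assms(2) by (intro cSUP_upper)
  then show ?thesis
    using Theta_OPT_le_min_Theta[OF assms(4-6), of s] assms(3) by simp
qed

text \<open>
  Every inner maximum in the definitions of \<open>G\<close> and \<open>H\<close> is a supremum of this form.
\<close>

lemma SUP_regret:
  assumes "x \<in> {pos P 0..pos P (len P)}" "S \<subseteq> scenarios P"
    and "\<And>s. s \<in> S \<Longrightarrow> f s \<le> Theta P x s"
    and "pos P 0 \<le> a" "a \<le> b" "b \<le> pos P (len P)"
  shows SUP_regret_le_R_max: "S \<noteq> {} \<Longrightarrow> (SUP s\<in>S. f s - min_Theta P a b s) \<le> R_max P x"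
    and le_SUP_regret: "u \<in> S \<Longrightarrow> v \<le> f u \<Longrightarrow> y \<in> {a..b} \<Longrightarrow>
      v - Theta P y u \<le> (SUP s\<in>S. f s - min_Theta P a b s)"
proof -
  have *: "f s - min_Theta P a b s \<le> R_max P x" if "s \<in> S" for s
    using that assms by (intro regret_le_R_max) auto
  then show "(SUP s\<in>S. f s - min_Theta P a b s) \<le> R_max P x" if "S \<noteq> {}"
    using that by (intro cSUP_least)
  assume "u \<in> S" "v \<le> f u" "y \<in> {a..b}"
  then have "v - Theta P y u \<le> f u - min_Theta P a b u"
    using min_Theta_le[of a b y u] assms by auto
  also have "\<dots> \<le> (SUP s\<in>S. f s - min_Theta P a b s)"
    using \<open>u \<in> S\<close> * by (intro cSUP_upper bdd_aboveI2) auto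
  finally show "v - Theta P y u \<le> (SUP s\<in>S. f s - min_Theta P a b s)" .
qed

section \<open>Concentrating weight towards the competing sink\<close>

text \<open>Meant for a sink at or right of \<open>pos P k\<close>: weight on \<open>0..k\<close>
  moves right with its total kept, which lowers the shorter prefixes, and the weights beyond
  \<open>k\<close> drop to \<open>wlo\<close>. Suffixes starting at or before \<open>k\<close> may
  grow, but do not enter the cost of such a sink.\<close>

lemma concentrate_right:
  assumes s: "s \<in> scenarios P" and k: "k \<le> len P"
  obtains i u where "i \<le> k" "u \<in> Scen P i k" "i < k \<Longrightarrow> u k = whi P k" "W u 0 k = W s 0 k"
    "\<And>t. t \<le> len P \<Longrightarrow> W u 0 t \<le> W s 0 t"
    "\<And>t. k < t \<Longrightarrow> t \<le> len P \<Longrightarrow> W u t (len P) \<le> W s t (len P)"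
proof -
  note b = scenarios_bounds[OF s]
  have "(\<Sum>t=0..k. wlo P t) \<le> W s 0 k" "W s 0 k \<le> (\<Sum>t=0..k. whi P t)"
    unfolding W_def using b k by (auto intro!: sum_mono)
  then obtain i \<alpha> where i: "i \<le> k" "\<alpha> \<in> {wlo P i..whi P i}"
      "(\<Sum>t=0..k. if t = i then \<alpha> else if i < t then whi P t else wlo P t) = W s 0 k"
    using fill_right[of 0 k "wlo P" "W s 0 k" "whi P"] by auto
  \<comment> \<open>The two parameters must agree when \<open>i = k\<close>; for
    \<open>i < k\<close> the filling has already raised vertex \<open>k\<close> to
    \<open>whi P k\<close>.\<close>
  define u where "u = scen P i k \<alpha> (if i = k then \<alpha> else whi P k)"
  have eq: "W u 0 k = W s 0 k"
    unfolding i(3)[symmetric] unfolding W_def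
    using i(1) k by (intro sum.cong) (auto simp: u_def scen_def)
  have lower: "u t \<le> s t" if "t < i \<or> k < t" "t \<le> len P" for t
    using that i(1) b(1)[of t] by (auto simp: u_def scen_def)
  have upper: "s t \<le> u t" if "i < t" "t \<le> k" for t
    using that k b(2)[of t] by (auto simp: u_def scen_def)
  show thesis
  proof
    show "u \<in> Scen P i k"
      unfolding u_def using i(1,2) k wlo_le_whi[of k] by (intro scen_in_Scen) auto
    show "W u 0 t \<le> W s 0 t" if "t \<le> len P" for t
    proof (cases "t \<le> k")
      case True
      then show ?thesis
        using eq k lower upper by - (rule W_prefix_mono_if_crossing[of i k], auto)
    next
      case False
      then have "W u (Suc k) t \<le> W s (Suc k) t"
        using that lower by (intro W_mono) auto
      then show ?thesis using False eq W_split[of 0 k t] by simp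
    qed
    show "W u t (len P) \<le> W s t (len P)" if "k < t" for t
      using that lower by (intro W_mono) auto
    show "u k = whi P k" if "i < k"
      using that k by (simp add: u_def scen_def)
  qed (use i(1) eq in auto)
qed

text \<open>Meant for a sink at or left of \<open>pos P k\<close>: weight on \<open>k..len P\<close>
  moves left with its total kept, and the weights before \<open>k\<close> drop to
  \<open>wlo\<close>.\<close>

lemma concentrate_left:
  assumes s: "s \<in> scenarios P" and k: "k \<le> len P"
  obtains j u where "k \<le> j" "j \<le> len P" "u \<in> Scen P k j" "k < j \<Longrightarrow> u k = whi P k"
    "W u k (len P) = W s k (len P)"
    "\<And>t. t < k \<Longrightarrow> W u 0 t \<le> W s 0 t"
    "\<And>t. t \<le> len P \<Longrightarrow> W u t (len P) \<le> W s t (len P)"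
proof -
  note b = scenarios_bounds[OF s]
  let ?n = "len P"
  have "(\<Sum>t=k..?n. wlo P t) \<le> W s k ?n" "W s k ?n \<le> (\<Sum>t=k..?n. whi P t)"
    unfolding W_def using b by (auto intro!: sum_mono)
  then obtain j \<beta> where j: "k \<le> j" "j \<le> ?n" "\<beta> \<in> {wlo P j..whi P j}"
      "(\<Sum>t=k..?n. if t = j then \<beta> else if t < j then whi P t else wlo P t) = W s k ?n"
    using fill_left[of k ?n "wlo P" "W s k ?n" "whi P"] k by auto
  define u where "u = scen P k j (if k = j then \<beta> else whi P k) \<beta>"
  have eq: "W u k ?n = W s k ?n"
    unfolding j(4)[symmetric] unfolding W_def
    using j(1) by (intro sum.cong) (auto simp: u_def scen_def)
  have lower: "u t \<le> s t" if "t < k \<or> j < t" "t \<le> ?n" for t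
    using that j(1) b(1)[of t] by (auto simp: u_def scen_def)
  have upper: "s t \<le> u t" if "k \<le> t" "t < j" for t
    using that j(2) b(2)[of t] by (auto simp: u_def scen_def)
  show thesis
  proof
    show "u \<in> Scen P k j"
      unfolding u_def using j(1-3) k wlo_le_whi[of k] by (intro scen_in_Scen) auto
    show "W u t ?n \<le> W s t ?n" if "t \<le> ?n" for t
    proof (cases "k \<le> t")
      case True
      then show ?thesis
        using that eq j(2) lower upper by - (rule W_suffix_mono_if_crossing[of k j], auto)
    next
      case False
      then obtain r where k': "k = Suc r" by (cases k) auto
      then have "W u t r \<le> W s t r"
        using False k lower by (intro W_mono) auto
      then show ?thesis using False k k' eq W_split[of t r ?n] by simp
    qed
    show "W u 0 t \<le> W s 0 t" if "t < k" for t
      using that k lower by (intro W_mono) auto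
    show "u k = whi P k" if "k < j"
      using that k by (simp add: u_def scen_def)
  qed (use j(1,2) eq in auto)
qed

text \<open>Meant for a sink between vertices \<open>l\<close> and \<open>Suc l\<close>: the block
  \<open>a..l\<close> is filled from its right end, the block \<open>Suc l..b\<close> from its left
  end. Taking \<open>0..k\<close> for \<open>a..b\<close> preserves \<open>g\<close> at
  \<open>k\<close>; taking \<open>k..len P\<close> preserves \<open>h\<close> at
  \<open>k\<close>.\<close>

lemma concentrate_inside:
  assumes s: "s \<in> scenarios P" and le: "a \<le> l" "l < b" "b \<le> len P"
  obtains i j u where "a \<le> i" "i \<le> l" "l < j" "j \<le> b" "u \<in> Scen P i j" "W u a b = W s a b"
    "\<And>t. t \<le> l \<Longrightarrow> W u 0 t \<le> W s 0 t"
    "\<And>t. l < t \<Longrightarrow> t \<le> len P \<Longrightarrow> W u t (len P) \<le> W s t (len P)"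
proof -
  note bd = scenarios_bounds[OF s]
  let ?n = "len P"
  have "(\<Sum>t=a..l. wlo P t) \<le> W s a l" "W s a l \<le> (\<Sum>t=a..l. whi P t)"
    unfolding W_def using bd le by (auto intro!: sum_mono)
  then obtain i \<alpha> where i: "a \<le> i" "i \<le> l" "\<alpha> \<in> {wlo P i..whi P i}"
      "(\<Sum>t=a..l. if t = i then \<alpha> else if i < t then whi P t else wlo P t) = W s a l"
    using fill_right[of a l "wlo P" "W s a l" "whi P"] le by auto
  have "(\<Sum>t=Suc l..b. wlo P t) \<le> W s (Suc l) b" "W s (Suc l) b \<le> (\<Sum>t=Suc l..b. whi P t)"
    unfolding W_def using bd le by (auto intro!: sum_mono)
  then obtain j \<beta> where j: "l < j" "j \<le> b" "\<beta> \<in> {wlo P j..whi P j}"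
      "(\<Sum>t=Suc l..b. if t = j then \<beta> else if t < j then whi P t else wlo P t) = W s (Suc l) b"
    using fill_left[of "Suc l" b "wlo P" "W s (Suc l) b" "whi P"] le by (auto simp: Suc_le_eq)
  \<comment> \<open>The two fillings meet at the cut: everything strictly between \<open>i\<close>
    and \<open>j\<close> is at \<open>whi\<close>, everything outside at \<open>wlo\<close>, which
    is the shape of one \<open>scen\<close>.\<close>
  define u where "u = scen P i j \<alpha> \<beta>"
  have eqL: "W u a l = W s a l"
    unfolding i(4)[symmetric] unfolding W_def using i(2) j(1) le
    by (intro sum.cong) (auto simp: u_def scen_def)
  have eqR: "W u (Suc l) b = W s (Suc l) b"
    unfolding j(4)[symmetric] unfolding W_def using i(2) j(1) le
    by (intro sum.cong) (auto simp: u_def scen_def)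
  have lower: "u t \<le> s t" if "t < i \<or> j < t" "t \<le> ?n" for t
    using that i(2) j(1) bd(1)[of t] by (auto simp: u_def scen_def)
  have upper: "s t \<le> u t" if "i < t" "t < j" for t
    using that j(2) le bd(2)[of t] by (auto simp: u_def scen_def)
  \<comment> \<open>Weights before \<open>a\<close> lie outside the filled block and drop to
    \<open>wlo\<close>, so equality on the block becomes an inequality for the whole prefix.\<close>
  have leL: "W u 0 l \<le> W s 0 l"
  proof (cases a)
    case (Suc r)
    have "W u 0 r \<le> W s 0 r"
      using Suc i(1) le lower by (intro W_mono) auto
    then show ?thesis using Suc le eqL W_split[of 0 r l] by simp
  qed (use eqL in simp)
  have leR: "W u (Suc l) ?n \<le> W s (Suc l) ?n"
  proof (cases "b = ?n")
    case False
    have "W u (Suc b) ?n \<le> W s (Suc b) ?n"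
      using j(2) lower by (intro W_mono) auto
    then show ?thesis using False le eqR W_split[of "Suc l" b ?n] by simp
  qed (use eqR in simp)
  show thesis
  proof
    show "u \<in> Scen P i j"
      unfolding u_def using i(1-3) j(1-3) by (intro scen_in_Scen) auto
    show "W u a b = W s a b"
      using eqL eqR le W_split[of a l b] by simp
    show "W u 0 t \<le> W s 0 t" if "t \<le> l" for t
      using that leL j(1) le lower upper by - (rule W_prefix_mono_if_crossing[of i l], auto)
    show "W u t ?n \<le> W s t ?n" if "l < t" "t \<le> ?n" for t
      using that leR i(2) j(2) le lower upper
      by - (rule W_suffix_mono_if_crossing[of "Suc l" j], auto)
  qed (use i(1,2) j(1,2) in auto)
qed

section \<open>Bounding \<open>G\<close> and \<open>H\<close> by the maximal regret\<close>

context
  fixes x :: real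
  assumes x: "x \<in> {pos P 0..pos P (len P)}"
begin

lemma Max_g_le_Theta:
  assumes "j \<le> len P" "pos P j < x"
  shows "Max ((\<lambda>t. g P t x s) ` {t. t \<le> len P \<and> pos P j \<le> pos P t \<and> pos P t < x}) \<le> Theta P x s"
  using assms by (subst Max_le_iff) (auto intro: g_le_Theta)

lemma Max_h_le_Theta:
  assumes "i \<le> len P" "x < pos P i"
  shows "Max ((\<lambda>t. h P t x s) ` {t. t \<le> len P \<and> x < pos P t \<and> pos P t \<le> pos P i}) \<le> Theta P x s"
  using assms by (subst Max_le_iff) (auto intro: h_le_Theta)

lemma G_le_R_max: "G P x \<le> ereal (R_max P x)"
proof -
  have "G_single P j x \<le> R_max P x" if "j \<le> len P" "pos P j < x" for j
    unfolding G_single_def using that x Scen_subset[of j j] Scen_whi_nonempty[of j j] pos_le_iff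
    by (intro SUP_regret_le_R_max g_le_Theta) auto
  moreover have "G_pair P i j x \<le> R_max P x" if "i < j" "j \<le> len P" "pos P j < x" for i j
  proof -
    \<comment> \<open>Fixing the weight at \<open>j\<close> still leaves the scenario with upper
      weights at both ends, so the supremum ranges over a nonempty set.\<close>
    have "scen P i j (whi P i) (whi P j) \<in> {s \<in> Scen P i j. s j = whi P j}"
      using that Scen_whi_nonempty[of i j] by (auto simp: scen_def)
    then show ?thesis
      unfolding G_pair_def using that x Scen_subset[of i j] pos_le_iff
      by (intro SUP_regret_le_R_max g_le_Theta) auto
  qed
  moreover have "G_bar P i j x \<le> R_max P x" if "i < j" "j \<le> len P" "pos P j < x" for i j
    unfolding G_bar_def using that x Scen_subset[of i j] Scen_whi_nonempty[of i j] pos_le_iff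
    by (intro SUP_regret_le_R_max Max_g_le_Theta) auto
  ultimately show ?thesis unfolding G_def Let_def by (auto intro!: SUP_least)
qed

lemma H_le_R_max: "H P x \<le> ereal (R_max P x)"
proof -
  have "H_single P i x \<le> R_max P x" if "i \<le> len P" "x < pos P i" for i
    unfolding H_single_def using that x Scen_subset[of i i] Scen_whi_nonempty[of i i] pos_le_iff
    by (intro SUP_regret_le_R_max h_le_Theta) auto
  moreover have "H_pair P i j x \<le> R_max P x" if "i < j" "j \<le> len P" "x < pos P i" for i j
  proof -
    have "scen P i j (whi P i) (whi P j) \<in> {s \<in> Scen P i j. s i = whi P i}"
      using that Scen_whi_nonempty[of i j] by (auto simp: scen_def)
    then show ?thesis
      unfolding H_pair_def using that x Scen_subset[of i j] pos_le_iff
      by (intro SUP_regret_le_R_max h_le_Theta) auto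
  qed
  moreover have "H_bar P i j x \<le> R_max P x" if "i < j" "j \<le> len P" "x < pos P i" for i j
    unfolding H_bar_def using that x Scen_subset[of i j] Scen_whi_nonempty[of i j] pos_le_iff
    by (intro SUP_regret_le_R_max Max_h_le_Theta) auto
  ultimately show ?thesis unfolding H_def Let_def by (auto intro!: SUP_least)
qed

section \<open>Bounding the regret of one scenario against one competing sink\<close>

lemma G_single_le_G: "j \<le> len P \<Longrightarrow> pos P j < x \<Longrightarrow> ereal (G_single P j x) \<le> G P x"
  unfolding G_def Let_def by (auto simp: le_max_iff_disj intro!: SUP_upper)

lemma G_pair_le_G: "i < j \<Longrightarrow> j \<le> len P \<Longrightarrow> pos P j < x \<Longrightarrow> ereal (G_pair P i j x) \<le> G P x"
  unfolding G_def Let_def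
  by (intro max.coboundedI2 max.coboundedI1 SUP_upper2[of "(i, j)"]) auto

lemma G_bar_le_G: "i < j \<Longrightarrow> j \<le> len P \<Longrightarrow> pos P j < x \<Longrightarrow> ereal (G_bar P i j x) \<le> G P x"
  unfolding G_def Let_def
  by (intro max.coboundedI2 SUP_upper2[of "(i, j)"]) auto

lemma H_single_le_H: "i \<le> len P \<Longrightarrow> x < pos P i \<Longrightarrow> ereal (H_single P i x) \<le> H P x"
  unfolding H_def Let_def by (auto simp: le_max_iff_disj intro!: SUP_upper)

lemma H_pair_le_H: "i < j \<Longrightarrow> j \<le> len P \<Longrightarrow> x < pos P i \<Longrightarrow> ereal (H_pair P i j x) \<le> H P x"
  unfolding H_def Let_def
  by (intro max.coboundedI2 max.coboundedI1 SUP_upper2[of "(i, j)"]) auto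

lemma H_bar_le_H: "i < j \<Longrightarrow> j \<le> len P \<Longrightarrow> x < pos P i \<Longrightarrow> ereal (H_bar P i j x) \<le> H P x"
  unfolding H_def Let_def
  by (intro max.coboundedI2 SUP_upper2[of "(i, j)"]) auto

text \<open>A sink at or beyond \<open>pos P k\<close> leads to \<open>G_single\<close> or
  \<open>G_pair\<close> with right index \<open>k\<close>. A sink before it leads to
  \<open>G_bar\<close>, where the right filling may stop at some \<open>j < k\<close>; the maximum
  over the vertices from \<open>j\<close> up to \<open>x\<close> then still contains the term of
  \<open>k\<close>.\<close>

lemma g_regret_le_G:
  assumes s: "s \<in> scenarios P" and y: "y \<in> {pos P 0..pos P (len P)}"
    and k: "k \<le> len P" "pos P k < x"
  shows "ereal (g P k x s - Theta P y s) \<le> G P x"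
proof (cases "pos P k \<le> y")
  case True
  obtain i u where i: "i \<le> k" and u: "u \<in> Scen P i k" "i < k \<Longrightarrow> u k = whi P k"
    and eq: "W u 0 k = W s 0 k" and
    W: "\<And>t. t \<le> len P \<Longrightarrow> W u 0 t \<le> W s 0 t"
      "\<And>t. k < t \<Longrightarrow> t \<le> len P \<Longrightarrow> W u t (len P) \<le> W s t (len P)"
    using concentrate_right[OF s k(1)] by blast
  have "k < t" if "t \<le> len P" "y < pos P t" for t
    using that True k pos_less_iff[of k t] by auto
  then have "Theta P y u \<le> Theta P y s"
    using y W by (intro Theta_mono) auto
  moreover have "g P k x u = g P k x s" using eq by (simp add: g_def)
  ultimately have "g P k x s - Theta P y s \<le> g P k x u - Theta P y u" by simp
  also have "ereal \<dots> \<le> G P x"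
  proof (cases "i = k")
    case True
    then have "g P k x u - Theta P y u \<le> G_single P k x"
      unfolding G_single_def
      using x y k u \<open>pos P k \<le> y\<close> Scen_subset[of k k] pos_le_iff
      by (intro le_SUP_regret[OF x]) (auto intro: g_le_Theta)
    then show ?thesis using G_single_le_G[OF k] by (meson ereal_less_eq(3) order_trans)
  next
    case False
    then have "g P k x u - Theta P y u \<le> G_pair P i k x"
      unfolding G_pair_def
      using x y i k u \<open>pos P k \<le> y\<close> Scen_subset[of i k] pos_le_iff
      by (intro le_SUP_regret[OF x]) (auto intro: g_le_Theta)
    then show ?thesis
      using G_pair_le_G[of i k] False i k by (meson ereal_less_eq(3) le_neq_implies_less order_trans)
  qed
  finally show ?thesis by simp
next
  case False
  \<comment> \<open>The search for the first vertex strictly right of \<open>y\<close> fails at 0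
    and succeeds at \<open>k\<close>; \<open>l\<close> is the vertex just before it.\<close>
  then have "\<not> y < pos P 0" "y < pos P k" using y by auto
  then obtain l where l: "l < k" "pos P l \<le> y" "y < pos P (Suc l)"
    using ex_least_nat_less[of "\<lambda>t. y < pos P t" k] by (auto simp: not_less)
  obtain i j u where ij: "i \<le> l" "l < j" "j \<le> k" and u: "u \<in> Scen P i j"
    and eq: "W u 0 k = W s 0 k" and
    W: "\<And>t. t \<le> l \<Longrightarrow> W u 0 t \<le> W s 0 t"
      "\<And>t. l < t \<Longrightarrow> t \<le> len P \<Longrightarrow> W u t (len P) \<le> W s t (len P)"
    using concentrate_inside[OF s, of 0 l k] l k by auto
  have t: "t \<le> l" if "t \<le> len P" "pos P t < y" for t
    using that l k pos_less_iff[of t "Suc l"] by auto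
  have t': "l < t" if "t \<le> len P" "y < pos P t" for t
    using that l k pos_less_iff[of l t] by auto
  have "Theta P y u \<le> Theta P y s"
    using y W t t' by (intro Theta_mono) auto
  moreover have "g P k x u = g P k x s" using eq by (simp add: g_def)
  ultimately have "g P k x s - Theta P y s \<le> g P k x u - Theta P y u" by simp
  also have "\<dots> \<le> G_bar P i j x"
  proof -
    have "pos P i \<le> y" "y \<le> pos P j" "pos P j \<le> pos P k"
      using ij l k pos_le_iff[of i l] pos_le_iff[of "Suc l" j] pos_le_iff[of j k] by auto
    then show ?thesis
      unfolding G_bar_def
      using x ij k u Scen_subset[of i j] pos_le_iff[of 0 i] pos_le_iff[of j "len P"]
      by (intro le_SUP_regret[OF x] Max_ge) (auto intro: Max_g_le_Theta)
  qed
  also have "ereal \<dots> \<le> G P x"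
    using ij k pos_le_iff[of j k] by (intro G_bar_le_G) auto
  finally show ?thesis by simp
qed

lemma h_regret_le_H:
  assumes s: "s \<in> scenarios P" and y: "y \<in> {pos P 0..pos P (len P)}"
    and k: "k \<le> len P" "x < pos P k"
  shows "ereal (h P k x s - Theta P y s) \<le> H P x"
proof (cases "y \<le> pos P k")
  case True
  obtain j u where j: "k \<le> j" "j \<le> len P" and u: "u \<in> Scen P k j" "k < j \<Longrightarrow> u k = whi P k"
    and eq: "W u k (len P) = W s k (len P)" and
    W: "\<And>t. t < k \<Longrightarrow> W u 0 t \<le> W s 0 t"
      "\<And>t. t \<le> len P \<Longrightarrow> W u t (len P) \<le> W s t (len P)"
    using concentrate_left[OF s k(1)] by blast
  have "t < k" if "t \<le> len P" "pos P t < y" for t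
    using that True k pos_less_iff[of t k] by auto
  then have "Theta P y u \<le> Theta P y s"
    using y W by (intro Theta_mono) auto
  moreover have "h P k x u = h P k x s" using eq by (simp add: h_def)
  ultimately have "h P k x s - Theta P y s \<le> h P k x u - Theta P y u" by simp
  also have "ereal \<dots> \<le> H P x"
  proof (cases "k = j")
    case True
    then have "h P k x u - Theta P y u \<le> H_single P k x"
      unfolding H_single_def
      using x y k u \<open>y \<le> pos P k\<close> Scen_subset[of k k] pos_le_iff
      by (intro le_SUP_regret[OF x]) (auto intro: h_le_Theta)
    then show ?thesis using H_single_le_H[OF k] by (meson ereal_less_eq(3) order_trans)
  next
    case False
    then have "h P k x u - Theta P y u \<le> H_pair P k j x"
      unfolding H_pair_def
      using x y j k u \<open>y \<le> pos P k\<close> Scen_subset[of k j] pos_le_iff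
      by (intro le_SUP_regret[OF x]) (auto intro: h_le_Theta)
    then show ?thesis
      using H_pair_le_H[of k j] False j k by (meson ereal_less_eq(3) le_neq_implies_less order_trans)
  qed
  finally show ?thesis by simp
next
  case False
  have "k < len P" using False y k pos_less_iff[of k "len P"] by auto
  \<comment> \<open>The non-strict test succeeds at \<open>len P\<close> even if \<open>y\<close> is
    the last vertex, and the conjunct \<open>k < t\<close> yields \<open>k \<le> l\<close>. If
    \<open>l = k\<close>, then \<open>pos P l \<le> y\<close> comes from the case
    assumption.\<close>
  then obtain l where "l < len P" "\<not> (k < l \<and> y \<le> pos P l)" "k < Suc l" "y \<le> pos P (Suc l)"
    using ex_least_nat_less[of "\<lambda>t. k < t \<and> y \<le> pos P t" "len P"] y by auto
  then have l: "k \<le> l" "l < len P" "pos P l \<le> y" "y \<le> pos P (Suc l)"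
    using False by (cases "k = l"; auto)+
  obtain i j u where ij: "k \<le> i" "i \<le> l" "l < j" "j \<le> len P" and u: "u \<in> Scen P i j"
    and eq: "W u k (len P) = W s k (len P)" and
    W: "\<And>t. t \<le> l \<Longrightarrow> W u 0 t \<le> W s 0 t"
      "\<And>t. l < t \<Longrightarrow> t \<le> len P \<Longrightarrow> W u t (len P) \<le> W s t (len P)"
    using concentrate_inside[OF s, of k l "len P"] l by auto
  have t: "t \<le> l" if "t \<le> len P" "pos P t < y" for t
    using that l pos_less_iff[of t "Suc l"] by auto
  have t': "l < t" if "t \<le> len P" "y < pos P t" for t
    using that l pos_less_iff[of l t] by auto
  have "Theta P y u \<le> Theta P y s"
    using y W t t' by (intro Theta_mono) auto
  moreover have "h P k x u = h P k x s" using eq by (simp add: h_def)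
  ultimately have "h P k x s - Theta P y s \<le> h P k x u - Theta P y u" by simp
  also have "\<dots> \<le> H_bar P i j x"
  proof -
    have "pos P i \<le> y" "y \<le> pos P j" "pos P k \<le> pos P i"
      using ij l k pos_le_iff[of i l] pos_le_iff[of "Suc l" j] pos_le_iff[of k i] by auto
    then show ?thesis
      unfolding H_bar_def
      using x ij k u Scen_subset[of i j] pos_le_iff[of 0 i] pos_le_iff[of j "len P"]
      by (intro le_SUP_regret[OF x] Max_ge) (auto intro: Max_h_le_Theta)
  qed
  also have "ereal \<dots> \<le> H P x"
    using ij k pos_le_iff[of k i] by (intro H_bar_le_H) auto
  finally show ?thesis by simp
qed

section \<open>From single regrets to \<open>R_max\<close>\<close>

lemma regret_le_max_G_H:
  assumes "s \<in> scenarios P" "y \<in> {pos P 0..pos P (len P)}"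
  shows "ereal (Theta P x s - Theta P y s) \<le> max (G P x) (H P x)"
  using Theta_attained[OF x, of s] g_regret_le_G[OF assms] h_regret_le_H[OF assms]
  by (metis max.coboundedI1 max.coboundedI2)

lemma R_max_le_max_G_H: "ereal (R_max P x) \<le> max (G P x) (H P x)"
proof -
  have "(\<lambda>t\<in>{..len P}. whi P t) \<in> scenarios P"
    using wlo_le_whi by (auto simp: scenarios_def)
  then have ne: "scenarios P \<noteq> {}" by blast
  \<comment> \<open>The maximum is finite: it dominates the real regret with \<open>x\<close> as its
    own competitor and lies below \<open>R_max P x\<close>. Being a real \<open>C\<close>, it can
    bound real suprema and infima.\<close>
  then have "max (G P x) (H P x) \<noteq> -\<infinity>"
    using regret_le_max_G_H[OF _ x] by fastforce
  moreover have "max (G P x) (H P x) \<noteq> \<infinity>"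
    using G_le_R_max H_le_R_max by (auto simp: max_def)
  ultimately obtain C where C: "max (G P x) (H P x) = ereal C"
    by (cases "max (G P x) (H P x)") auto
  have "Theta P x s - Theta_OPT P s \<le> C" if "s \<in> scenarios P" for s
  proof -
    \<comment> \<open>The bound for every competing sink passes to the infimum, so no optimal sink
      has to be exhibited.\<close>
    have "Theta P x s - C \<le> Theta_OPT P s"
      unfolding Theta_OPT_def min_Theta_def
      using x regret_le_max_G_H[OF that] C by (intro cINF_greatest) (auto simp: algebra_simps)
    then show ?thesis by simp
  qed
  then have "R_max P x \<le> C" unfolding R_max_def using ne by (intro cSUP_least)
  then show ?thesis using C by simp
qed

end

end

theorem theorem3:
  fixes P :: path_network and x :: real
  assumes "valid_path P"
    and "x \<in> {pos P 0..pos P (len P)}"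
  shows "ereal (R_max P x) = max (G P x) (H P x)"
  using R_max_le_max_G_H[OF assms] G_le_R_max[OF assms] H_le_R_max[OF assms]
  by (intro antisym) auto

end
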